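(* Let $X$ be a Tychonoff space. If $B_1(X)$ is locally complete, then $B_1(X)$ is a Choquet space and, hence, a Baire space.
   Context: $B_1(X)$ is the space of all functions $f:X\to\mathbb{R}$ that are pointwise limits of sequences of continuous real-valued functions on $X$, a real locally convex space with the pointwise topology (subspace topology from $\mathbb{R}^X$). A Hausdorff locally convex space $E$ is locally complete if the closed absolutely convex hull of every null sequence in $E$ is compact. A nonempty topological space $Y$ is a Choquet space if the second player (Nonempty) has a winning strategy in the Choquet game on $Y$: players Empty and Nonempty alternately choose nonempty open sets $U_0\supseteq V_0\supseteq U_1\supseteq V_1\supseteq\cdots$ (Empty chooses $U_n$, Nonempty chooses $V_n$), and Nonempty wins if $\bigcap_n V_n\neq\emptyset$. A space is Baire if the intersection of countably many dense open subsets is dense. *)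

theory Defs
  imports "HOL-Analysis.Analysis" "HOL-Library.Function_Algebras"
begin

instantiation "fun" :: (type, real_vector) real_vector
begin

definition scaleR_fun :: "real \<Rightarrow> ('a \<Rightarrow> 'b) \<Rightarrow> 'a \<Rightarrow> 'b"
  where "scaleR_fun c f = (\<lambda>x. c *\<^sub>R f x)"

instance
  by standard (simp_all add: scaleR_fun_def plus_fun_def scaleR_add_right scaleR_add_left)

end

definition Tychonoff_space :: "'a topology \<Rightarrow> bool"
  where "Tychonoff_space X \<longleftrightarrow> completely_regular_space X \<and> Hausdorff_space X"

text \<open>A real function on the space \<open>X\<close> is represented by its extension by 0 outside
  \<^term>\<open>topspace X\<close>; this makes the functions on \<open>X\<close> a linear subspace of the type
  \<^typ>\<open>'a \<Rightarrow> real\<close> (unlike the convention of \<^const>\<open>extensional\<close>). Lemma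
  \<open>homeomorphic_map_B1\<close> below shows that the resulting topology is the pointwise one.\<close>

definition B1_set :: "'a topology \<Rightarrow> ('a \<Rightarrow> real) set"
  where "B1_set X =
    {f. (\<forall>x. x \<notin> topspace X \<longrightarrow> f x = 0) \<and>
        (\<exists>g. (\<forall>n::nat. continuous_map X euclideanreal (g n)) \<and>
             (\<forall>x\<in>topspace X. (\<lambda>n. g n x) \<longlonglongrightarrow> f x))}"

definition B1 :: "'a topology \<Rightarrow> ('a \<Rightarrow> real) topology"
  where "B1 X = subtopology (powertop_real UNIV) (B1_set X)"

definition absolutely_convex :: "'v::real_vector set \<Rightarrow> bool"
  where "absolutely_convex A \<longleftrightarrow> convex A \<and> (\<forall>c x. \<bar>c\<bar> \<le> 1 \<longrightarrow> x \<in> A \<longrightarrow> c *\<^sub>R x \<in> A)"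

text \<open>Below, \<open>E\<close> is meant to be a Hausdorff locally convex topology whose carrier
  \<^term>\<open>topspace E\<close> is a linear subspace of the type \<^typ>\<open>'v\<close>.\<close>

definition closed_absolutely_convex_hull :: "'v::real_vector topology \<Rightarrow> 'v set \<Rightarrow> 'v set"
  where "closed_absolutely_convex_hull E S = (\<lambda>A. closedin E A \<and> absolutely_convex A) hull S"

definition locally_complete :: "'v::real_vector topology \<Rightarrow> bool"
  where "locally_complete E \<longleftrightarrow>
    (\<forall>s :: nat \<Rightarrow> 'v. range s \<subseteq> topspace E \<and> limitin E s 0 sequentially \<longrightarrow>
       compactin E (closed_absolutely_convex_hull E (range s)))"

text \<open>A strategy \<open>\<sigma>\<close> of Nonempty maps the list \<open>[U\<^sub>0, \<dots>, U\<^sub>n]\<close> of the moves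
  made so far by Empty to the reply \<open>V\<^sub>n\<close>. (Nonempty's own earlier moves need not be
  recorded, since \<open>\<sigma>\<close> determines them.)\<close>

definition choquet_reply :: "('a set list \<Rightarrow> 'a set) \<Rightarrow> (nat \<Rightarrow> 'a set) \<Rightarrow> nat \<Rightarrow> 'a set"
  where "choquet_reply \<sigma> U n = \<sigma> (map U [0..<Suc n])"

definition empty_legal ::
    "'a topology \<Rightarrow> ('a set list \<Rightarrow> 'a set) \<Rightarrow> (nat \<Rightarrow> 'a set) \<Rightarrow> nat \<Rightarrow> bool"
  where "empty_legal Y \<sigma> U n \<longleftrightarrow>
    openin Y (U n) \<and> U n \<noteq> {} \<and> (n > 0 \<longrightarrow> U n \<subseteq> choquet_reply \<sigma> U (n - 1))"

text \<open>The first conjunct makes \<open>\<sigma>\<close> answer legally for as long as Empty has played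
  legally, so that a play never stops; the second is the winning condition.\<close>

definition nonempty_winning_strategy ::
    "'a topology \<Rightarrow> ('a set list \<Rightarrow> 'a set) \<Rightarrow> bool"
  where "nonempty_winning_strategy Y \<sigma> \<longleftrightarrow>
    (\<forall>U. (\<forall>n. (\<forall>m\<le>n. empty_legal Y \<sigma> U m) \<longrightarrow>
             openin Y (choquet_reply \<sigma> U n) \<and> choquet_reply \<sigma> U n \<noteq> {} \<and>
             choquet_reply \<sigma> U n \<subseteq> U n) \<and>
         ((\<forall>n. empty_legal Y \<sigma> U n) \<longrightarrow> (\<Inter>n. choquet_reply \<sigma> U n) \<noteq> {}))"

definition Choquet_space :: "'a topology \<Rightarrow> bool"
  where "Choquet_space Y \<longleftrightarrow> topspace Y \<noteq> {} \<and> (\<exists>\<sigma>. nonempty_winning_strategy Y \<sigma>)"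

definition Baire_space :: "'a topology \<Rightarrow> bool"
  where "Baire_space Y \<longleftrightarrow>
    (\<forall>\<G>. countable \<G> \<and> (\<forall>G\<in>\<G>. openin Y G \<and> Y closure_of G = topspace Y) \<longrightarrow>
         Y closure_of (topspace Y \<inter> \<Inter>\<G>) = topspace Y)"

lemma topspace_B1: "topspace (B1 X) = B1_set X"
  by (simp add: B1_def)

lemma subspace_B1: "subspace (topspace (B1 X))"
proof -
  have "0 \<in> B1_set X"
    by (auto simp: B1_set_def zero_fun_def intro!: exI[of _ "\<lambda>n x. 0"])
  moreover have "f + g \<in> B1_set X" if "f \<in> B1_set X" "g \<in> B1_set X" for f g
  proof -
    obtain p q where "\<And>n::nat. continuous_map X euclideanreal (p n)"
        "\<forall>x\<in>topspace X. (\<lambda>n. p n x) \<longlonglongrightarrow> f x"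
        "\<And>n::nat. continuous_map X euclideanreal (q n)"
        "\<forall>x\<in>topspace X. (\<lambda>n. q n x) \<longlonglongrightarrow> g x"
      using \<open>f \<in> B1_set X\<close> \<open>g \<in> B1_set X\<close> unfolding B1_set_def by blast
    then show ?thesis
      using that unfolding B1_set_def plus_fun_def
      by (auto intro!: exI[of _ "\<lambda>n x. p n x + q n x"] continuous_map_add tendsto_add)
  qed
  moreover have "c *\<^sub>R f \<in> B1_set X" if f: "f \<in> B1_set X" for c f
  proof -
    obtain p where "\<And>n::nat. continuous_map X euclideanreal (p n)"
        "\<forall>x\<in>topspace X. (\<lambda>n. p n x) \<longlonglongrightarrow> f x"
      using f unfolding B1_set_def by blast
    then show ?thesis
      using that unfolding B1_set_def scaleR_fun_def
      by (auto intro!: exI[of _ "\<lambda>n x. c * p n x"] continuous_map_real_mult_left tendsto_mult_left)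
  qed
  ultimately show ?thesis
    by (simp add: subspace_def topspace_B1)
qed

lemma homeomorphic_map_B1:
  "homeomorphic_map (B1 X)
     (subtopology (powertop_real (topspace X))
       {f \<in> extensional (topspace X).
          \<exists>g. (\<forall>n::nat. continuous_map X euclideanreal (g n)) \<and>
              (\<forall>x\<in>topspace X. (\<lambda>n. g n x) \<longlonglongrightarrow> f x)})
     (\<lambda>f. restrict f (topspace X))"
  (is "homeomorphic_map _ (subtopology _ ?B) ?r")
proof -
  let ?e = "\<lambda>f x. if x \<in> topspace X then f x else (0::real)"
  have "continuous_map (powertop_real UNIV) (powertop_real (topspace X)) ?r"
    by (auto simp: continuous_map_componentwise intro: continuous_map_product_projection)
  then have r: "continuous_map (B1 X) (subtopology (powertop_real (topspace X)) ?B) ?r"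
    unfolding B1_def B1_set_def
    by (auto simp: continuous_map_in_subtopology continuous_map_from_subtopology
        cong: conj_cong)
  have "continuous_map (powertop_real (topspace X)) euclideanreal (\<lambda>f. ?e f x)" for x
    by (cases "x \<in> topspace X") (auto intro: continuous_map_product_projection)
  then have "continuous_map (powertop_real (topspace X)) (powertop_real UNIV) ?e"
    by (simp add: continuous_map_componentwise_UNIV)
  then have e: "continuous_map (subtopology (powertop_real (topspace X)) ?B) (B1 X) ?e"
    unfolding B1_def B1_set_def
    by (auto simp: continuous_map_in_subtopology continuous_map_from_subtopology)
  have "homeomorphic_maps (B1 X) (subtopology (powertop_real (topspace X)) ?B) ?r ?e"
    unfolding homeomorphic_maps_def using r e
    by (auto simp: topspace_B1 B1_set_def extensional_def restrict_def)
  then show ?thesis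
    by (rule homeomorphic_maps_imp_map)
qed

end

(* Local completeness forces every real function on a countable set A of points of X to extend to a
   function in B1(X): by complete regularity the points a of A lie in pairwise disjoint sets Z_a, each
   the zero set of countably many continuous functions, so that indicator functions of the Z_a are
   Baire-one. Arbitrary multiples of these have disjoint supports, hence form a null sequence, and the
   sum of the series lies in the closed absolutely convex hull of a rescaling of the sequence. Given the
   extension property, Nonempty wins by replying with basic neighbourhoods whose finite supports grow
   and whose intervals are nested with their closures: any choice of a value in the intersection of the
   intervals at every point of the countable union of the supports extends to a function in B1(X). *)
theory Submission
  imports Defs
begin

section \<open>Choquet spaces are Baire\<close>

text \<open>Empty opens with a given open set \<open>W\<close> and cuts each reply with the next
  dense open set. A point common to all replies then lies in \<open>W\<close> and in every member of
  the family.\<close>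

lemma Choquet_imp_Baire:
  assumes "Choquet_space Y"
  shows "Baire_space Y"
  unfolding Baire_space_def
proof (intro allI impI)
  fix \<G> assume \<G>: "countable \<G> \<and> (\<forall>G\<in>\<G>. openin Y G \<and> Y closure_of G = topspace Y)"
  obtain \<sigma> where \<sigma>: "nonempty_winning_strategy Y \<sigma>"
    using assms by (auto simp: Choquet_space_def)
  \<comment> \<open>Inserting \<open>topspace Y\<close> makes the family nonempty, so that it can be
    enumerated by all natural numbers, possibly with repetitions.\<close>
  define G where "G n = from_nat_into (insert (topspace Y) \<G>) n" for n
  have rangeG: "range G = insert (topspace Y) \<G>"
    unfolding G_def using \<G> by (intro range_from_nat_into) auto
  have opG: "openin Y (G n)" and denseG: "Y closure_of G n = topspace Y" for n
    using rangeI[of G n] \<G> unfolding rangeG by auto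
  have "(topspace Y \<inter> \<Inter>\<G>) \<inter> W \<noteq> {}" if W: "openin Y W" "W \<noteq> {}" for W
  proof -
    \<comment> \<open>\<open>L n\<close> is the list of Empty's moves up to round \<open>n\<close>.
      The recursion runs over lists because a reply depends on all earlier moves.\<close>
    define L where "L = rec_nat [W] (\<lambda>n l. l @ [\<sigma> l \<inter> G n])"
    define U where "U n = last (L n)" for n
    have L0: "L 0 = [W]" and LS: "L (Suc n) = L n @ [\<sigma> (L n) \<inter> G n]" for n
      by (simp_all add: L_def)
    have L: "L n = map U [0..<Suc n]" for n
      by (induction n) (simp_all add: L0 LS U_def)
    have reply: "choquet_reply \<sigma> U n = \<sigma> (L n)" for n
      by (simp only: choquet_reply_def L)
    have US: "U (Suc n) = choquet_reply \<sigma> U n \<inter> G n" for n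
      unfolding reply by (simp add: U_def LS)
    have U0: "U 0 = W"
      by (simp add: U_def L0)
    \<comment> \<open>The replies of \<open>\<sigma>\<close> are known to be open and nonempty only
      after legal moves, so legality of a move and nonemptiness of the following one are proved
      together round by round.\<close>
    have legal: "\<forall>m\<le>n. empty_legal Y \<sigma> U m" for n
    proof (induction n)
      case 0
      then show ?case using W by (simp add: empty_legal_def U0)
    next
      case (Suc n)
      have V: "openin Y (choquet_reply \<sigma> U n)" "choquet_reply \<sigma> U n \<noteq> {}"
        using \<sigma> Suc unfolding nonempty_winning_strategy_def by blast+
      then have "choquet_reply \<sigma> U n \<inter> G n \<noteq> {}"
        using denseG[of n] opG[of n] openin_subset[OF V(1)]
        by (metis dense_intersects_open inf_commute)
      then have "empty_legal Y \<sigma> U (Suc n)"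
        using V opG unfolding empty_legal_def US by auto
      with Suc show ?case
        by (auto simp: le_Suc_eq)
    qed
    then have "(\<Inter>n. choquet_reply \<sigma> U n) \<noteq> {}"
      using \<sigma> unfolding nonempty_winning_strategy_def by blast
    then obtain z where z: "z \<in> choquet_reply \<sigma> U n" for n
      by blast
    have VU: "choquet_reply \<sigma> U n \<subseteq> U n" for n
      using \<sigma> legal[of n] unfolding nonempty_winning_strategy_def by blast
    have "z \<in> W"
      using VU[of 0] z U0 by blast
    moreover have "z \<in> G n" for n
      using VU[of "Suc n"] z US[of n] by blast
    then have "z \<in> \<Inter>(range G)" by blast
    ultimately show ?thesis
      unfolding rangeG by blast
  qed
  then show "Y closure_of (topspace Y \<inter> \<Inter>\<G>) = topspace Y"
    by (metis dense_intersects_open inf_commute)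
qed

section \<open>Extension from countable sets\<close>

text \<open>The continuous function \<open>g m\<close> is 1 on the common zero set. Elsewhere some
  \<open>\<phi> k x\<close> is nonzero, and once \<open>m\<close> exceeds \<open>k\<close> and its
  reciprocal modulus, the subtracted term is at least 1 and \<open>g m x\<close> is 0.\<close>

lemma indicator_zero_set_in_B1_set:
  fixes \<phi> :: "nat \<Rightarrow> 'a \<Rightarrow> real"
  assumes cont: "\<And>k. continuous_map X euclideanreal (\<phi> k)"
  shows "indicat_real {x \<in> topspace X. \<forall>k. \<phi> k x = 0} \<in> B1_set X"
proof -
  let ?Z = "{x \<in> topspace X. \<forall>k. \<phi> k x = 0}"
  define g where "g m x = max 0 (1 - real m * (\<Sum>k<m. \<bar>\<phi> k x\<bar>))" for m x
  have "continuous_map X euclideanreal (g m)" for m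
    unfolding g_def
    by (intro continuous_map_real_max continuous_map_diff continuous_map_real_mult
        continuous_map_sum continuous_map_real_abs cont) auto
  moreover have "(\<lambda>m. g m x) \<longlonglongrightarrow> indicat_real ?Z x" if x: "x \<in> topspace X" for x
  proof (cases "x \<in> ?Z")
    case True
    then show ?thesis by (simp add: g_def)
  next
    case False
    with x obtain k where k: "\<phi> k x \<noteq> 0" by auto
    have "\<forall>\<^sub>F m in sequentially. 1 / \<bar>\<phi> k x\<bar> \<le> real m \<and> k < m"
      by (intro eventually_conj eventually_gt_at_top)
        (rule eventually_compose_filterlim[OF eventually_ge_at_top filterlim_real_sequentially])
    then have "\<forall>\<^sub>F m in sequentially. g m x = 0"
    proof eventually_elim
      case (elim m)
      have "1 \<le> real m * \<bar>\<phi> k x\<bar>"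
        using elim k by (simp add: field_simps)
      also have "\<dots> \<le> real m * (\<Sum>k<m. \<bar>\<phi> k x\<bar>)"
        using elim by (intro mult_left_mono member_le_sum) auto
      finally show ?case by (simp add: g_def)
    qed
    then show ?thesis
      using False by (auto intro: tendsto_eventually)
  qed
  ultimately show ?thesis
    unfolding B1_set_def mem_Collect_eq
    by (intro conjI exI[of _ g] allI ballI) (simp_all add: indicator_def)
qed

lemma Tychonoff_separate_points:
  assumes "Tychonoff_space X" "a \<in> topspace X" "b \<in> topspace X" "a \<noteq> b"
  obtains f where "continuous_map X euclideanreal f" "f a = 0" "f b = 1"
proof -
  have "closedin X {b}" "a \<in> topspace X - {b}"
    using assms by (auto simp: Tychonoff_space_def closedin_Hausdorff_singleton)
  then obtain f where "continuous_map X (top_of_set {0..1::real}) f" "f a = 0" "f ` {b} \<subseteq> {1}"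
    using assms(1) unfolding Tychonoff_space_def completely_regular_space_def by metis
  then show thesis
    by (auto simp: continuous_map_in_subtopology intro: that[of f])
qed

lemma disjoint_B1_indicators:
  fixes A :: "'a set"
  assumes X: "Tychonoff_space X" and A: "countable A" "A \<subseteq> topspace X"
  obtains Z :: "'a \<Rightarrow> 'a set"
  where "\<And>a. a \<in> A \<Longrightarrow> a \<in> Z a"
    "\<And>a b x. a \<in> A \<Longrightarrow> b \<in> A \<Longrightarrow> x \<in> Z a \<Longrightarrow> x \<in> Z b \<Longrightarrow> a = b"
    "\<And>a. a \<in> A \<Longrightarrow> indicat_real (Z a) \<in> B1_set X"
proof -
  have "\<exists>f. continuous_map X euclideanreal f \<and> f a = 0 \<and> f b = 1"
    if "a \<in> A" "b \<in> A" "a \<noteq> b" for a b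
    using Tychonoff_separate_points[OF X] that A(2) by (metis subsetD)
  then obtain \<psi> where \<psi>: "\<And>a b. a \<in> A \<Longrightarrow> b \<in> A \<Longrightarrow> a \<noteq> b \<Longrightarrow>
      continuous_map X euclideanreal (\<psi> a b) \<and> \<psi> a b a = 0 \<and> \<psi> a b b = (1::real)"
    by metis
  \<comment> \<open>Vanishing of \<open>\<phi> a k\<close> at \<open>x\<close> means
    \<open>\<psi> a b x = 0\<close> and \<open>\<psi> b a x = 1\<close>. Exchanging \<open>a\<close>
    and \<open>b\<close> demands the opposite values, whence disjointness. The value 0 covers the
    index of \<open>a\<close> itself, where there is nothing to separate.\<close>
  define \<phi> where "\<phi> a k x = (let b = from_nat_into A k in
    if b = a then 0 else \<bar>\<psi> a b x\<bar> + \<bar>\<psi> b a x - 1\<bar>)" for a k x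
  define Z where "Z a = {x \<in> topspace X. \<forall>k. \<phi> a k x = 0}" for a
  show thesis
  proof
    show "a \<in> Z a" if a: "a \<in> A" for a
    proof -
      have "from_nat_into A k \<in> A" for k
        using a by (intro from_nat_into) auto
      then show ?thesis
        using \<psi> a A(2) by (auto simp: Z_def \<phi>_def Let_def)
    qed
    show "a = b" if ab: "a \<in> A" "b \<in> A" and x: "x \<in> Z a" "x \<in> Z b" for a b x
    proof (rule ccontr)
      assume "a \<noteq> b"
      obtain i j where "from_nat_into A i = a" "from_nat_into A j = b"
        using ab A(1) by (metis from_nat_into_to_nat_on)
      moreover have "\<phi> a j x = 0" "\<phi> b i x = 0"
        using x by (auto simp: Z_def)
      ultimately show False
        using \<open>a \<noteq> b\<close> by (auto simp: \<phi>_def)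
    qed
    show "indicat_real (Z a) \<in> B1_set X" if a: "a \<in> A" for a
      unfolding Z_def
    proof (rule indicator_zero_set_in_B1_set)
      fix k
      have "from_nat_into A k \<in> A"
        using a by (intro from_nat_into) auto
      then have "from_nat_into A k = a \<or>
          continuous_map X euclideanreal (\<psi> a (from_nat_into A k)) \<and>
          continuous_map X euclideanreal (\<psi> (from_nat_into A k) a)"
        using \<psi> a by metis
      then show "continuous_map X euclideanreal (\<phi> a k)"
        unfolding \<phi>_def Let_def
        by (cases "from_nat_into A k = a")
          (auto intro!: continuous_map_add continuous_map_real_abs continuous_map_diff)
    qed
  qed
qed

text \<open>The sum is the midpoint of \<open>s 0\<close> and the same kind of sum for the shifted
  sequence, so convexity suffices in the induction step. The weights add up to less than 1; the
  missing mass sits at 0, which belongs to \<open>A\<close> as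
  \<open>0 *\<^sub>R s 0\<close>.\<close>

lemma absolutely_convex_geometric_sum:
  fixes s :: "nat \<Rightarrow> 'v::real_vector"
  assumes A: "absolutely_convex A" and s: "range s \<subseteq> A"
  shows "(\<Sum>n<N. (1/2) ^ Suc n *\<^sub>R s n) \<in> A"
  using s
proof (induction N arbitrary: s)
  case 0
  then have "0 *\<^sub>R s 0 \<in> A"
    using A unfolding absolutely_convex_def by (metis abs_zero rangeI subsetD zero_le_one)
  then show ?case by simp
next
  case (Suc N)
  let ?t = "\<Sum>n<N. (1/2) ^ Suc n *\<^sub>R s (Suc n)"
  have "range (\<lambda>n. s (Suc n)) \<subseteq> A"
    using Suc.prems by auto
  then have "?t \<in> A"
    by (rule Suc.IH)
  moreover have "s 0 \<in> A"
    using Suc.prems by auto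
  ultimately have "(1/2) *\<^sub>R s 0 + (1/2) *\<^sub>R ?t \<in> A"
    using A unfolding absolutely_convex_def convex_def by auto
  also have "(1/2) *\<^sub>R s 0 + (1/2) *\<^sub>R ?t = (\<Sum>n<Suc N. (1/2) ^ Suc n *\<^sub>R s n)"
    unfolding sum.lessThan_Suc_shift by (simp add: scaleR_sum_right)
  finally show ?case .
qed

lemma limitin_powertop_real_UNIV:
  "limitin (powertop_real UNIV) s f F \<longleftrightarrow> (\<forall>x. ((\<lambda>n. s n x) \<longlongrightarrow> f x) F)"
  by (auto simp: limitin_componentwise)

text \<open>At each point only finitely many terms are nonzero, so the sequence remains null after
  multiplication by powers of 2. The partial sums of the original series are geometric combinations
  of the rescaled sequence and stay in its compact hull, which also contains their pointwise
  limit.\<close>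

lemma locally_complete_B1_point_finite_sum:
  fixes s :: "nat \<Rightarrow> 'a \<Rightarrow> real"
  assumes lc: "locally_complete (B1 X)"
    and s: "\<And>n. s n \<in> B1_set X" and fin: "\<And>x. finite {n. s n x \<noteq> 0}"
  shows "(\<lambda>x. \<Sum>n | s n x \<noteq> 0. s n x) \<in> B1_set X"
proof -
  let ?F = "\<lambda>x. \<Sum>n | s n x \<noteq> 0. s n x"
  define t where "t n = 2 ^ Suc n *\<^sub>R s n" for n
  have t: "range t \<subseteq> topspace (B1 X)"
    using s subspace_B1[of X] by (auto simp: t_def topspace_B1 intro: subspace_scale)
  have bound: "\<forall>\<^sub>F n in sequentially. s n x = 0" for x
    using fin[of x] by (simp add: eventually_cofinite flip: cofinite_eq_sequentially)
  have "(\<lambda>n. t n x) \<longlonglongrightarrow> 0" for x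
    using bound[of x]
    by (intro tendsto_eventually) (auto simp: t_def scaleR_fun_def elim: eventually_mono)
  then have "limitin (B1 X) t 0 sequentially"
    using t subspace_0[OF subspace_B1[of X]]
    by (auto simp: B1_def limitin_subtopology limitin_powertop_real_UNIV zero_fun_def topspace_B1
        intro!: always_eventually)
  then have "compactin (B1 X) (closed_absolutely_convex_hull (B1 X) (range t))" (is "compactin _ ?K")
    using lc t unfolding locally_complete_def by blast
  \<comment> \<open>The limit is not yet known to be Baire-one, so closedness within
    \<open>B1 X\<close> would not do. Compactness carries over to the full product, which is
    Hausdorff, and so gives closedness there.\<close>
  then have K: "compactin (powertop_real UNIV) ?K" "?K \<subseteq> B1_set X"
    by (auto simp: B1_def compactin_subtopology)
  have "Hausdorff_space (powertop_real (UNIV :: 'a set))"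
    by (simp add: Hausdorff_space_product_topology)
  then have clo: "closedin (powertop_real UNIV) ?K"
    using K(1) compactin_imp_closedin by blast
  define P where "P N = (\<Sum>n<N. (1/2) ^ Suc n *\<^sub>R t n)" for N
  have P: "P N \<in> ?K" for N
    unfolding closed_absolutely_convex_hull_def hull_def P_def
    by (blast intro: absolutely_convex_geometric_sum)
  have P_apply: "P N x = (\<Sum>n<N. s n x)" for N x
    unfolding P_def
    by (induction N) (simp_all add: t_def scaleR_fun_def plus_fun_def power_one_over)
  have "(\<lambda>N. P N x) \<longlonglongrightarrow> ?F x" for x
  proof -
    obtain M where M: "\<And>n. n \<ge> M \<Longrightarrow> s n x = 0"
      using bound[of x] unfolding eventually_sequentially by blast
    have "P N x = ?F x" if "N \<ge> M" for N
    proof -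
      have "{n. s n x \<noteq> 0} \<subseteq> {..<N}"
      proof
        fix n assume "n \<in> {n. s n x \<noteq> 0}"
        then show "n \<in> {..<N}"
          using M[of n] that by (cases "n < N") auto
      qed
      then show ?thesis
        unfolding P_apply by (intro sum.mono_neutral_right) auto
    qed
    then show ?thesis
      by (intro tendsto_eventually) (auto simp: eventually_sequentially)
  qed
  then have "limitin (powertop_real UNIV) P ?F sequentially"
    by (simp add: limitin_powertop_real_UNIV)
  then have "?F \<in> ?K"
    by (rule limitin_closedin[OF _ clo]) (use P in auto)
  then show ?thesis using K by blast
qed

lemma B1_extension_from_countable:
  fixes v :: "'a \<Rightarrow> real"
  assumes X: "Tychonoff_space X" and lc: "locally_complete (B1 X)"
    and A: "countable A" "A \<subseteq> topspace X"
  obtains f where "f \<in> B1_set X" "\<And>a. a \<in> A \<Longrightarrow> f a = v a"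
proof -
  obtain Z where Z: "\<And>a. a \<in> A \<Longrightarrow> a \<in> Z a"
    "\<And>a b x. a \<in> A \<Longrightarrow> b \<in> A \<Longrightarrow> x \<in> Z a \<Longrightarrow> x \<in> Z b \<Longrightarrow> a = b"
    "\<And>a. a \<in> A \<Longrightarrow> indicat_real (Z a) \<in> B1_set X"
    using disjoint_B1_indicators[OF X A] by metis
  define e where "e = to_nat_on A"
  have e: "inj_on e A"
    unfolding e_def using A(1) by (rule inj_on_to_nat_on)
  \<comment> \<open>The points of \<open>A\<close> are indexed by the injection \<open>e\<close>,
    which also allows finite \<open>A\<close>; the indices outside its image receive the zero
    function.\<close>
  define s :: "nat \<Rightarrow> 'a \<Rightarrow> real" where
    "s n = (if n \<in> e ` A then let a = inv_into A e n in v a *\<^sub>R indicat_real (Z a) else 0)" for n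
  have s_e: "s (e a) = v a *\<^sub>R indicat_real (Z a)" if "a \<in> A" for a
    using that e by (simp add: s_def)
  have s_out: "s n = 0" if "n \<notin> e ` A" for n
    using that by (simp add: s_def)
  have s_supp: "\<exists>a\<in>A. n = e a \<and> x \<in> Z a" if "s n x \<noteq> 0" for n x
  proof -
    have "n \<in> e ` A"
      using that s_out by force
    then show ?thesis
      using that s_e by (auto simp: scaleR_fun_def indicator_def split: if_splits)
  qed
  \<comment> \<open>By disjointness a point lies in at most one \<open>Z a\<close>, so at most one
    term is nonzero there.\<close>
  have supp: "{n. s n x \<noteq> 0} \<subseteq> {e a}" if "a \<in> A" "x \<in> Z a" for a x
    using s_supp that Z(2) by blast
  have fin: "finite {n. s n x \<noteq> 0}" for x
  proof (cases "\<exists>a\<in>A. x \<in> Z a")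
    case True
    then show ?thesis using supp by (meson finite.intros finite_subset)
  next
    case False
    then have "{n. s n x \<noteq> 0} = {}" using s_supp by blast
    then show ?thesis by simp
  qed
  have s: "s n \<in> B1_set X" for n
  proof (cases "n \<in> e ` A")
    case True
    then obtain a where "a \<in> A" "n = e a" by blast
    then show ?thesis
      using s_e[of a] subspace_scale[OF subspace_B1, of "indicat_real (Z a)" X "v a"] Z(3)[of a]
      by (simp add: topspace_B1)
  next
    case False
    then show ?thesis
      using s_out subspace_0[OF subspace_B1[of X]] by (simp add: topspace_B1)
  qed
  show thesis
  proof
    show "(\<lambda>x. \<Sum>n | s n x \<noteq> 0. s n x) \<in> B1_set X"
      by (rule locally_complete_B1_point_finite_sum[OF lc s fin])
    show "(\<Sum>n | s n a \<noteq> 0. s n a) = v a" if a: "a \<in> A" for a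
    proof -
      \<comment> \<open>The index set on the left is empty when \<open>v a = 0\<close>; enlarging it
        to \<open>{e a}\<close> treats both cases alike.\<close>
      have "(\<Sum>n | s n a \<noteq> 0. s n a) = (\<Sum>n\<in>{e a}. s n a)"
        using supp[OF a Z(1)[OF a]] by (intro sum.mono_neutral_left) auto
      also have "\<dots> = v a"
        using a Z(1) by (simp add: s_e scaleR_fun_def)
      finally show ?thesis .
    qed
  qed
qed

section \<open>The winning strategy\<close>

text \<open>The triple of support, centre and common radius is also the state that the strategy
  carries from round to round.\<close>

definition B1_nbhd :: "'a topology \<Rightarrow> 'a set \<times> ('a \<Rightarrow> real) \<times> real \<Rightarrow> ('a \<Rightarrow> real) set"
  where "B1_nbhd X = (\<lambda>(F, f, \<epsilon>). {h \<in> B1_set X. \<forall>x\<in>F. \<bar>h x - f x\<bar> < \<epsilon>})"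

lemma openin_B1_nbhd:
  assumes "finite F"
  shows "openin (B1 X) (B1_nbhd X (F, f, \<epsilon>))"
proof -
  have "openin (powertop_real UNIV) {h \<in> topspace (powertop_real UNIV). h x \<in> ball (f x) \<epsilon>}"
    for x :: 'a
    by (rule openin_continuous_map_preimage[where Y = euclideanreal])
      (auto intro: continuous_map_product_projection)
  then have "openin (powertop_real UNIV) {h. h x \<in> ball (f x) \<epsilon>}" for x :: 'a
    by simp
  then have "openin (powertop_real UNIV)
      (topspace (powertop_real UNIV) \<inter> (\<Inter>x\<in>F. {h. h x \<in> ball (f x) \<epsilon>}))"
    using assms by (intro openin_Int_Inter openin_topspace) auto
  moreover have "B1_nbhd X (F, f, \<epsilon>) = (\<Inter>x\<in>F. {h. h x \<in> ball (f x) \<epsilon>}) \<inter> B1_set X"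
    by (auto simp: B1_nbhd_def dist_real_def abs_minus_commute)
  ultimately show ?thesis
    unfolding B1_def openin_subtopology by auto
qed

lemma openin_B1_contains_nbhd:
  assumes U: "openin (B1 X) U" and f: "f \<in> U"
  obtains F \<epsilon> where "finite F" "F \<subseteq> topspace X" "\<epsilon> > 0" "B1_nbhd X (F, f, \<epsilon>) \<subseteq> U"
proof -
  obtain T where T: "openin (powertop_real UNIV) T" "U = T \<inter> B1_set X"
    using U unfolding B1_def openin_subtopology by blast
  obtain W where W: "finite {i. W i \<noteq> UNIV}" "\<And>i. open (W i)" "f \<in> Pi\<^sub>E UNIV W" "Pi\<^sub>E UNIV W \<subseteq> T"
    using T f unfolding openin_product_topology_alt by fastforce
  let ?S = "{i. W i \<noteq> UNIV}"
  have "\<exists>\<delta>>0. ball (f i) \<delta> \<subseteq> W i" for i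
    using W(2)[of i] PiE_mem[OF W(3), of i] by (simp add: open_contains_ball)
  then obtain \<delta> where \<delta>: "\<And>i. \<delta> i > 0" "\<And>i. ball (f i) (\<delta> i) \<subseteq> W i"
    by metis
  \<comment> \<open>The extra 1 keeps the minimum meaningful when no coordinate is
    restricted.\<close>
  define \<epsilon> where "\<epsilon> = Min (insert 1 (\<delta> ` ?S))"
  have \<epsilon>: "\<epsilon> > 0" "\<And>i. i \<in> ?S \<Longrightarrow> \<epsilon> \<le> \<delta> i"
    using W(1) \<delta> by (auto simp: \<epsilon>_def)
  have "B1_nbhd X (?S \<inter> topspace X, f, \<epsilon>) \<subseteq> U"
  proof
    fix h assume h: "h \<in> B1_nbhd X (?S \<inter> topspace X, f, \<epsilon>)"
    then have hB: "h \<in> B1_set X" by (simp add: B1_nbhd_def)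
    have "h i \<in> W i" for i
    proof (cases "i \<in> ?S \<and> i \<in> topspace X")
      case True
      then have "h i \<in> ball (f i) (\<delta> i)"
        using h \<epsilon>(2)[of i] by (force simp: B1_nbhd_def dist_real_def abs_minus_commute)
      then show ?thesis using \<delta> by blast
    next
      \<comment> \<open>Either \<open>W i\<close> is everything, or \<open>i\<close> lies outside
        the space, where \<open>h\<close> and \<open>f\<close> both vanish. Hence the support can be
        cut down to \<open>topspace X\<close>.\<close>
      case False
      moreover have "h i = f i" if "i \<notin> topspace X"
        using that hB f T(2) by (auto simp: B1_set_def)
      ultimately show ?thesis
        using W(3) by (auto simp: PiE_iff)
    qed
    then have "h \<in> Pi\<^sub>E UNIV W" by (simp add: PiE_iff)
    then show "h \<in> U" using hB W(4) T(2) by blast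
  qed
  with W(1) \<epsilon>(1) show thesis
    by (intro that[of "?S \<inter> topspace X" \<epsilon>]) auto
qed

text \<open>The strict inequality in the last conjunct makes the new closed interval at each point of the old
  support lie in the old open interval.\<close>

definition B1_refines ::
    "'a topology \<Rightarrow> 'a set \<times> ('a \<Rightarrow> real) \<times> real \<Rightarrow> ('a \<Rightarrow> real) set \<Rightarrow> 'a set \<times> ('a \<Rightarrow> real) \<times> real \<Rightarrow> bool"
  where "B1_refines X = (\<lambda>(F, f, \<epsilon>) U (F', f', \<epsilon>').
    finite F' \<and> F' \<subseteq> topspace X \<and> f' \<in> B1_set X \<and> \<epsilon>' > 0 \<and> B1_nbhd X (F', f', \<epsilon>') \<subseteq> U \<and>
    F \<subseteq> F' \<and> (\<forall>x\<in>F. \<bar>f' x - f x\<bar> + \<epsilon>' < \<epsilon>))"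

lemma B1_refinesD:
  assumes "B1_refines X p U (F, f, \<epsilon>)"
  shows "finite F" "F \<subseteq> topspace X" "f \<in> B1_set X" "\<epsilon> > 0" "B1_nbhd X (F, f, \<epsilon>) \<subseteq> U"
  using assms by (cases p; simp add: B1_refines_def)+

lemma ex_B1_refines:
  assumes F: "finite F" "F \<subseteq> topspace X"
    and U: "openin (B1 X) U" "U \<noteq> {}" "U \<subseteq> B1_nbhd X (F, f, \<epsilon>)"
  shows "\<exists>q. B1_refines X (F, f, \<epsilon>) U q"
proof -
  obtain f' where f': "f' \<in> U" using U by blast
  obtain G \<delta> where G: "finite G" "G \<subseteq> topspace X" "\<delta> > 0" "B1_nbhd X (G, f', \<delta>) \<subseteq> U"
    using openin_B1_contains_nbhd[OF U(1) f'] by metis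
  have f'B: "f' \<in> B1_nbhd X (F, f, \<epsilon>)"
    using f' U by blast
  \<comment> \<open>The bound \<open>\<delta>\<close> keeps the new neighbourhood inside
    \<open>U\<close>; half of the slack at each point of \<open>F\<close> gives the strict
    inequality of \<open>B1_refines\<close>.\<close>
  define \<rho> where "\<rho> = Min (insert \<delta> ((\<lambda>x. (\<epsilon> - \<bar>f' x - f x\<bar>) / 2) ` F))"
  have \<rho>: "\<rho> > 0" "\<rho> \<le> \<delta>"
    using F(1) G(3) f'B by (auto simp: \<rho>_def B1_nbhd_def)
  have "\<bar>f' x - f x\<bar> + \<rho> < \<epsilon>" if "x \<in> F" for x
  proof -
    have "\<rho> \<le> (\<epsilon> - \<bar>f' x - f x\<bar>) / 2"
      unfolding \<rho>_def using F(1) that by (intro Min_le) auto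
    moreover have "\<bar>f' x - f x\<bar> < \<epsilon>"
      using f'B that by (auto simp: B1_nbhd_def)
    ultimately show ?thesis by argo
  qed
  moreover have "B1_nbhd X (F \<union> G, f', \<rho>) \<subseteq> U"
    using G(4) \<rho>(2) by (force simp: B1_nbhd_def)
  ultimately have "B1_refines X (F, f, \<epsilon>) U (F \<union> G, f', \<rho>)"
    using F G \<rho> f'B by (auto simp: B1_refines_def B1_nbhd_def)
  then show ?thesis by blast
qed

lemma Choquet_space_B1:
  assumes ext: "\<And>A v. countable A \<Longrightarrow> A \<subseteq> topspace X \<Longrightarrow> \<exists>f\<in>B1_set X. \<forall>a\<in>A. f a = v a"
  shows "Choquet_space (B1 X)"
proof -
  \<comment> \<open>In a legal play a refinement exists by \<open>ex_B1_refines\<close>, so the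
    choice is then meaningful.\<close>
  define step where "step p U = (SOME q. B1_refines X p U q)" for p U
  \<comment> \<open>With empty support the initial neighbourhood is all of
    \<open>B1_set X\<close>.\<close>
  define p0 where "p0 = ({}::'a set, (0::'a \<Rightarrow> real), 1::real)"
  define \<sigma> where "\<sigma> Us = B1_nbhd X (foldl step p0 Us)" for Us
  have "nonempty_winning_strategy (B1 X) \<sigma>"
    unfolding nonempty_winning_strategy_def
  proof (intro allI conjI)
    fix U :: "nat \<Rightarrow> ('a \<Rightarrow> real) set"
    \<comment> \<open>\<open>p n\<close> is the state before the move \<open>U n\<close>, hence the
      reply to that move comes from \<open>p (Suc n)\<close>.\<close>
    define p where "p n = foldl step p0 (map U [0..<n])" for n
    have reply: "choquet_reply \<sigma> U n = B1_nbhd X (p (Suc n))" for n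
      unfolding choquet_reply_def \<sigma>_def p_def ..
    have p_Suc: "p (Suc n) = step (p n) (U n)" for n
      by (simp add: p_def)
    have refines: "B1_refines X (p n) (U n) (p (Suc n))"
      if "\<forall>m\<le>n. empty_legal (B1 X) \<sigma> U m" for n
      using that
    proof (induction n)
      case 0
      then have "openin (B1 X) (U 0)" "U 0 \<noteq> {}"
        by (auto simp: empty_legal_def)
      moreover from this have "U 0 \<subseteq> B1_nbhd X p0"
        using openin_subset by (fastforce simp: p0_def B1_nbhd_def topspace_B1)
      ultimately have "\<exists>q. B1_refines X p0 (U 0) q"
        unfolding p0_def by (intro ex_B1_refines) auto
      then show ?case
        unfolding p_Suc step_def by (simp add: p_def someI_ex)
    next
      case (Suc n)
      then have IH: "B1_refines X (p n) (U n) (p (Suc n))" by simp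
      have "openin (B1 X) (U (Suc n))" "U (Suc n) \<noteq> {}" "U (Suc n) \<subseteq> B1_nbhd X (p (Suc n))"
        using Suc.prems[rule_format, of "Suc n"] by (auto simp: empty_legal_def reply)
      moreover obtain F f \<epsilon> where q: "p (Suc n) = (F, f, \<epsilon>)"
        by (metis prod_cases3)
      moreover have "finite F" "F \<subseteq> topspace X"
        using IH unfolding q by (rule B1_refinesD)+
      ultimately have "\<exists>q. B1_refines X (p (Suc n)) (U (Suc n)) q"
        by (metis ex_B1_refines)
      then show ?case
        unfolding p_Suc[of "Suc n"] step_def by (rule someI_ex)
    qed
    show "(\<forall>m\<le>n. empty_legal (B1 X) \<sigma> U m) \<longrightarrow>
        openin (B1 X) (choquet_reply \<sigma> U n) \<and> choquet_reply \<sigma> U n \<noteq> {} \<and>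
        choquet_reply \<sigma> U n \<subseteq> U n" for n
    proof
      assume legal: "\<forall>m\<le>n. empty_legal (B1 X) \<sigma> U m"
      obtain F f \<epsilon> where q: "p (Suc n) = (F, f, \<epsilon>)"
        by (metis prod_cases3)
      have R: "finite F" "f \<in> B1_set X" "\<epsilon> > 0" "B1_nbhd X (F, f, \<epsilon>) \<subseteq> U n"
        using refines[OF legal] unfolding q by (rule B1_refinesD)+
      then have "f \<in> B1_nbhd X (F, f, \<epsilon>)"
        by (simp add: B1_nbhd_def)
      then show "openin (B1 X) (choquet_reply \<sigma> U n) \<and> choquet_reply \<sigma> U n \<noteq> {} \<and>
          choquet_reply \<sigma> U n \<subseteq> U n"
        unfolding reply q using R openin_B1_nbhd by blast
    qed
    show "(\<forall>n. empty_legal (B1 X) \<sigma> U n) \<longrightarrow> (\<Inter>n. choquet_reply \<sigma> U n) \<noteq> {}"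
    proof
      assume legal: "\<forall>n. empty_legal (B1 X) \<sigma> U n"
      define F where "F n = fst (p n)" for n
      define f where "f n = fst (snd (p n))" for n
      define \<epsilon> where "\<epsilon> n = snd (snd (p n))" for n
      have p: "p n = (F n, f n, \<epsilon> n)" for n
        by (simp add: F_def f_def \<epsilon>_def)
      have R: "F (Suc n) \<subseteq> topspace X" "finite (F (Suc n))" "\<epsilon> (Suc n) > 0" "F n \<subseteq> F (Suc n)"
        "\<And>x. x \<in> F n \<Longrightarrow> \<bar>f (Suc n) x - f n x\<bar> + \<epsilon> (Suc n) < \<epsilon> n" for n
        using refines[of n] legal unfolding p by (auto simp: B1_refines_def)
      have F0: "F 0 = {}"
        by (simp add: F_def p_def p0_def)
      have F_mono: "F m \<subseteq> F n" if "m \<le> n" for m n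
        using R(4) that by (rule lift_Suc_mono_le)
      have countable: "countable (\<Union>n. F n)" and sub: "(\<Union>n. F n) \<subseteq> topspace X"
      proof -
        have "finite (F n) \<and> F n \<subseteq> topspace X" for n
          using R(1,2) F0 by (cases n) auto
        then show "countable (\<Union>n. F n)" "(\<Union>n. F n) \<subseteq> topspace X"
          by (auto intro: countable_finite)
      qed
      have nested: "f m x - \<epsilon> m \<le> f n x - \<epsilon> n \<and> f n x + \<epsilon> n \<le> f m x + \<epsilon> m"
        if "x \<in> F m" "m \<le> n" for x m n
        using that(2)
      proof (induction n rule: dec_induct)
        case (step k)
        have "x \<in> F k" using F_mono[OF step(1)] that(1) by blast
        from R(5)[OF this] step(3) show ?case by linarith
      qed simp
      \<comment> \<open>The intervals at \<open>x\<close> are compared from the first stage whose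
        support contains \<open>x\<close>; the supremum of their lower ends lies in all of them.
        Outside all supports the value of \<open>v\<close> is arbitrary.\<close>
      define v where "v x = (SUP n\<in>{n. x \<in> F n}. f n x - \<epsilon> n)" for x
      have \<epsilon>_pos: "\<epsilon> n > 0" if "x \<in> F n" for x n
        using that R(3) F0 by (cases n) auto
      \<comment> \<open>Of two intervals at \<open>x\<close>, the later one is contained in the
        earlier one, and the radii are positive.\<close>
      have lower_upper: "f m x - \<epsilon> m \<le> f n x + \<epsilon> n" if "x \<in> F m" "x \<in> F n" for x m n
        using nested[OF that(1), of n] nested[OF that(2), of m] \<epsilon>_pos[OF that(1)] \<epsilon>_pos[OF that(2)]
        by (cases "m \<le> n") auto
      have v: "f n x - \<epsilon> n \<le> v x" "v x \<le> f n x + \<epsilon> n" if x: "x \<in> F n" for x n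
      proof -
        have "bdd_above ((\<lambda>m. f m x - \<epsilon> m) ` {m. x \<in> F m})"
          using lower_upper x by (intro bdd_aboveI[of _ "f n x + \<epsilon> n"]) auto
        then show "f n x - \<epsilon> n \<le> v x"
          unfolding v_def using x by (intro cSUP_upper) auto
        show "v x \<le> f n x + \<epsilon> n"
          unfolding v_def using x lower_upper by (intro cSUP_least) auto
      qed
      obtain h where h: "h \<in> B1_set X" "\<And>x. x \<in> (\<Union>n. F n) \<Longrightarrow> h x = v x"
        using ext[OF countable sub, of v] by blast
      \<comment> \<open>The value lies in the closed interval of stage \<open>Suc n\<close>, which
        is contained in the open interval of stage \<open>n\<close>.\<close>
      have "\<bar>h x - f n x\<bar> < \<epsilon> n" if x: "x \<in> F n" for n x
      proof -
        have "x \<in> F (Suc n)" using R(4) x by blast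
        from v[OF this] R(5)[OF x] h(2)[of x] x show ?thesis by force
      qed
      then have "h \<in> (\<Inter>n. choquet_reply \<sigma> U n)"
        unfolding reply p using h(1) by (auto simp: B1_nbhd_def)
      then show "(\<Inter>n. choquet_reply \<sigma> U n) \<noteq> {}" by blast
    qed
  qed
  moreover have "topspace (B1 X) \<noteq> {}"
    using subspace_0[OF subspace_B1[of X]] by blast
  ultimately show ?thesis
    unfolding Choquet_space_def by blast
qed

theorem corollary3p7:
  fixes X :: "'a topology"
  assumes "Tychonoff_space X"
    and "locally_complete (B1 X)"
  shows "Choquet_space (B1 X) \<and> Baire_space (B1 X)"
proof -
  have "Choquet_space (B1 X)"
    by (rule Choquet_space_B1) (metis B1_extension_from_countable[OF assms])
  then show ?thesis
    using Choquet_imp_Baire by blast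
qed

end
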